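(* Let $G$ be a clustered graph on $mn$ vertices with clusters $C_i=\{v_{i,1},\dots,v_{i,m}\}$, $i=1,\dots,n$, satisfying the following two conditions. (1) (Commuting condition) For all $i_1,j_1,i_2,j_2\in\{1,\dots,n\}$ and all $\alpha,\beta\in\{1,\dots,m\}$, $$\left|\mathrm{nbd}_{C_{j_1}}(v_{i_1,\alpha})\cap \mathrm{nbd}_{C_{i_2}}(v_{j_2,\beta})\right| = \left|\mathrm{nbd}_{C_{i_1}}(v_{j_1,\beta})\cap \mathrm{nbd}_{C_{j_2}}(v_{i_2,\alpha})\right|.$$ (2) (Normality condition) For all $i\neq j$ and all $\alpha,\beta\in\{1,\dots,m\}$, the number of common neighbours in $C_j$ of $v_{i,\alpha}$ and $v_{i,\beta}$ equals the number of common neighbours in $C_i$ of $v_{j,\alpha}$ and $v_{j,\beta}$. Then $G$ and its graph theoretical partial transpose $G^\tau$ are cospectral.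
   Context: All graphs are finite, simple and undirected. A clustered graph on $mn$ vertices with clusters $C_i=\{v_{i,1},\dots,v_{i,m}\}$, $i=1,\dots,n$, is a graph whose labelled vertex set is partitioned into these clusters. For a vertex $v_{i,\alpha}$ and a cluster $C_j$, $\mathrm{nbd}_{C_j}(v_{i,\alpha})=\{\beta\in\{1,\dots,m\} : v_{i,\alpha}\text{ and } v_{j,\beta}\text{ are adjacent}\}$. The graph theoretical partial transpose $G^\tau$ is the graph on the same vertex set obtained from $G$ by keeping every edge inside a cluster and every edge of the form $(v_{i,k},v_{j,k})$, and replacing every edge $(v_{i,k},v_{j,l})$ with $i\neq j$, $k\neq l$ by the edge $(v_{i,l},v_{j,k})$; equivalently, if the adjacency matrix of $G$ is the block matrix $[A_{i,j}]$ with $(A_{i,j})_{\alpha\beta}=1$ iff $v_{i,\alpha}\sim v_{j,\beta}$, then the adjacency matrix of $G^\tau$ is $[A_{i,j}^t]$. Cospectral means the adjacency matrices have the same multiset of eigenvalues. *)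

theory Defs
  imports "Graph_Theory.Pair_Digraph" "Jordan_Normal_Form.Char_Poly"
    "HOL-Computational_Algebra.Polynomial"
begin

text \<open>
  Finite simple undirected graphs are the loop-free symmetric finite digraphs of the
  locale \<^locale>\<open>pair_graph\<close>: an edge between \<open>u\<close> and \<open>w\<close> is present in \<open>G\<close> iff
  \<open>(u, w) \<in> parcs G\<close> (equivalently \<open>(w, u) \<in> parcs G\<close>).

  In a clustered graph, \<open>v i \<alpha>\<close> is the \<open>\<alpha>\<close>-th vertex of the \<open>i\<close>-th cluster; both indices
  start at 1.
\<close>

definition clustered_graph ::
  "nat \<Rightarrow> nat \<Rightarrow> (nat \<Rightarrow> nat \<Rightarrow> 'a) \<Rightarrow> 'a pair_pre_digraph \<Rightarrow> bool" where
  "clustered_graph m n v G \<longleftrightarrow>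
     pair_graph G \<and> bij_betw (\<lambda>(i, \<alpha>). v i \<alpha>) ({1..n} \<times> {1..m}) (pverts G)"

definition cluster :: "nat \<Rightarrow> (nat \<Rightarrow> nat \<Rightarrow> 'a) \<Rightarrow> nat \<Rightarrow> 'a set" where
  "cluster m v i = v i ` {1..m}"

text \<open>Neighbourhoods in a cluster are sets of positions, not of vertices, so that
  neighbourhoods in different clusters can be intersected.\<close>

definition nbd ::
  "nat \<Rightarrow> (nat \<Rightarrow> nat \<Rightarrow> 'a) \<Rightarrow> 'a pair_pre_digraph \<Rightarrow> nat \<Rightarrow> 'a \<Rightarrow> nat set" where
  "nbd m v G j u = {\<beta> \<in> {1..m}. (u, v j \<beta>) \<in> parcs G}"

definition common_neighbours :: "'a pair_pre_digraph \<Rightarrow> 'a set \<Rightarrow> 'a \<Rightarrow> 'a \<Rightarrow> 'a set" where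
  "common_neighbours G C u w = {x \<in> C. (u, x) \<in> parcs G \<and> (w, x) \<in> parcs G}"

definition partial_transpose ::
  "nat \<Rightarrow> nat \<Rightarrow> (nat \<Rightarrow> nat \<Rightarrow> 'a) \<Rightarrow> 'a pair_pre_digraph \<Rightarrow> 'a pair_pre_digraph" where
  "partial_transpose m n v G =
     \<lparr> pverts = pverts G,
       parcs =
         {(v i k, v i l) | i k l.
            i \<in> {1..n} \<and> k \<in> {1..m} \<and> l \<in> {1..m} \<and> (v i k, v i l) \<in> parcs G} \<union>
         {(v i k, v j k) | i j k.
            i \<in> {1..n} \<and> j \<in> {1..n} \<and> k \<in> {1..m} \<and> (v i k, v j k) \<in> parcs G} \<union>
         {(v i l, v j k) | i j k l.
            i \<in> {1..n} \<and> j \<in> {1..n} \<and> i \<noteq> j \<and> k \<in> {1..m} \<and> l \<in> {1..m} \<and> k \<noteq> l \<and>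
            (v i k, v j l) \<in> parcs G} \<rparr>"

text \<open>The adjacency matrix is taken with respect to an enumeration \<open>xs\<close> of the vertices.\<close>

definition adjacency_matrix :: "'a list \<Rightarrow> 'a pair_pre_digraph \<Rightarrow> complex mat" where
  "adjacency_matrix xs G =
     mat (length xs) (length xs) (\<lambda>(p, q). if (xs ! p, xs ! q) \<in> parcs G then 1 else 0)"

text \<open>Eigenvalues are counted with algebraic multiplicity.\<close>

definition eigenvalue_mset :: "complex mat \<Rightarrow> complex multiset" where
  "eigenvalue_mset A = proots (char_poly A)"

text \<open>Cospectrality is required for every choice of enumerations of the two vertex sets;
  the finiteness conjuncts guarantee that such enumerations exist.\<close>

definition cospectral :: "'a pair_pre_digraph \<Rightarrow> 'b pair_pre_digraph \<Rightarrow> bool" where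
  "cospectral G H \<longleftrightarrow> finite (pverts G) \<and> finite (pverts H) \<and>
     (\<forall>xs ys. distinct xs \<and> set xs = pverts G \<and> distinct ys \<and> set ys = pverts H \<longrightarrow>
        eigenvalue_mset (adjacency_matrix xs G) = eigenvalue_mset (adjacency_matrix ys H))"

lemma clustered_graph_label_eq_iff:
  assumes "clustered_graph m n v G"
    and "i \<in> {1..n}" "j \<in> {1..n}" "\<alpha> \<in> {1..m}" "\<beta> \<in> {1..m}"
  shows "v i \<alpha> = v j \<beta> \<longleftrightarrow> i = j \<and> \<alpha> = \<beta>"
proof -
  have "inj_on (\<lambda>(i, \<alpha>). v i \<alpha>) ({1..n} \<times> {1..m})"
    using assms(1) by (simp add: clustered_graph_def bij_betw_def)
  from inj_on_eq_iff[OF this, of "(i, \<alpha>)" "(j, \<beta>)"] assms(2-) show ?thesis by auto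
qed

text \<open>The block description: off-diagonal blocks of the adjacency matrix are transposed,
  diagonal blocks (being symmetric) are unchanged.\<close>

lemma partial_transpose_adjacent_iff:
  assumes G: "clustered_graph m n v G"
    and ij: "i \<in> {1..n}" "j \<in> {1..n}" and ab: "\<alpha> \<in> {1..m}" "\<beta> \<in> {1..m}"
  shows "(v i \<alpha>, v j \<beta>) \<in> parcs (partial_transpose m n v G) \<longleftrightarrow> (v i \<beta>, v j \<alpha>) \<in> parcs G"
    (is "?L \<longleftrightarrow> ?R")
proof -
  interpret pair_graph G using G by (simp add: clustered_graph_def)
  have sym: "(x, y) \<in> parcs G \<Longrightarrow> (y, x) \<in> parcs G" for x y
    using pair_sym_arcs by (auto simp: symmetric_def sym_def)
  note eq = clustered_graph_label_eq_iff[OF G]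
  show ?thesis
  proof
    assume ?L
    then show ?R
      unfolding partial_transpose_def using ij ab by (auto simp: eq dest: sym)
  next
    assume R: ?R
    show ?L
    proof (cases "i = j")
      case True
      then have "(v i \<alpha>, v i \<beta>) \<in> parcs G" using R sym by simp
      then show ?thesis using True ij ab unfolding partial_transpose_def by auto
    next
      case False
      then show ?thesis
      proof (cases "\<alpha> = \<beta>")
        case True
        then show ?thesis using R ij ab unfolding partial_transpose_def by auto
      next
        case ne: False
        have "\<exists>i' j' k l. (v i \<alpha>, v j \<beta>) = (v i' l, v j' k) \<and> i' \<in> {1..n} \<and> j' \<in> {1..n} \<and>
            i' \<noteq> j' \<and> k \<in> {1..m} \<and> l \<in> {1..m} \<and> k \<noteq> l \<and> (v i' k, v j' l) \<in> parcs G"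
          using R ij ab False ne by blast
        then show ?thesis unfolding partial_transpose_def by simp
      qed
    qed
  qed
qed

lemma clustered_graph_partial_transpose:
  assumes G: "clustered_graph m n v G"
  shows "clustered_graph m n v (partial_transpose m n v G)"
proof -
  interpret pair_graph G using G by (simp add: clustered_graph_def)
  have sym: "(x, y) \<in> parcs G \<Longrightarrow> (y, x) \<in> parcs G" for x y
    using pair_sym_arcs by (auto simp: symmetric_def sym_def)
  have bij: "bij_betw (\<lambda>(i, \<alpha>). v i \<alpha>) ({1..n} \<times> {1..m}) (pverts G)"
    using G by (simp add: clustered_graph_def)
  then have V: "pverts G = (\<lambda>(i, \<alpha>). v i \<alpha>) ` ({1..n} \<times> {1..m})"
    by (simp add: bij_betw_def)
  let ?H = "partial_transpose m n v G"
  have verts: "pverts ?H = pverts G" by (simp add: partial_transpose_def)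
  have arcs: "\<exists>i j \<alpha> \<beta>. i \<in> {1..n} \<and> j \<in> {1..n} \<and> \<alpha> \<in> {1..m} \<and> \<beta> \<in> {1..m} \<and>
      e = (v i \<alpha>, v j \<beta>) \<and> (v i \<beta>, v j \<alpha>) \<in> parcs G" if "e \<in> parcs ?H" for e
  proof -
    have "\<exists>i j \<alpha> \<beta>. i \<in> {1..n} \<and> j \<in> {1..n} \<and> \<alpha> \<in> {1..m} \<and> \<beta> \<in> {1..m} \<and> e = (v i \<alpha>, v j \<beta>)"
      using that unfolding partial_transpose_def pair_pre_digraph.simps by blast
    with that show ?thesis using partial_transpose_adjacent_iff[OF G] by blast
  qed
  have sub: "parcs ?H \<subseteq> pverts G \<times> pverts G"
    using arcs unfolding V by fastforce
  have "pair_graph ?H"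
  proof
    show "fst e \<in> pverts ?H" "snd e \<in> pverts ?H" if "e \<in> parcs ?H" for e
      using that sub unfolding verts by (auto simp: mem_Times_iff)
    show "finite (pverts ?H)" by (simp add: verts pair_finite_verts)
    show "finite (parcs ?H)"
      using sub by (rule finite_subset) (simp add: pair_finite_verts)
    show "fst e \<noteq> snd e" if "e \<in> parcs ?H" for e
      using arcs[OF that] clustered_graph_label_eq_iff[OF G] pair_no_loops by fastforce
    have "(y, x) \<in> parcs ?H" if "(x, y) \<in> parcs ?H" for x y
      using arcs[OF that] partial_transpose_adjacent_iff[OF G] sym by blast
    then show "symmetric ?H" by (auto simp: symmetric_def sym_def)
  qed
  then show ?thesis using bij by (simp add: clustered_graph_def verts)
qed

end

theory Submission
  imports Defs "Jordan_Normal_Form.Schur_Decomposition"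
begin

text \<open>
  Write the adjacency matrix as a block matrix \<open>A = [A\<^sub>i\<^sub>j]\<close>, so that \<open>A\<^sub>j\<^sub>i\<close> is the transpose of
  \<open>A\<^sub>i\<^sub>j\<close>. The commuting condition says exactly that all blocks commute pairwise. Hence the
  blocks of every power of \<open>A\<close> commute with the blocks of \<open>A\<close>, and by induction on \<open>k\<close> the
  \<open>(i, j)\<close> block of the \<open>k\<close>-th power of \<open>[A\<^sub>i\<^sub>j\<^sup>t]\<close> is the transpose of the \<open>(i, j)\<close> block of
  \<open>A\<^sup>k\<close>. So \<open>A\<close> and its partial transpose have the same traces of powers, i.e. the same power
  sums of eigenvalues, and these determine the eigenvalues with multiplicity.
\<close>

section \<open>Power sums determine a multiset\<close>

lemma sum_mset_poly_eq_if_power_sums_eq: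
  fixes M N :: "'a :: comm_ring_1 multiset"
  assumes "\<And>k. (\<Sum>x\<in>#M. x ^ k) = (\<Sum>x\<in>#N. x ^ k)"
  shows "(\<Sum>x\<in>#M. poly p x) = (\<Sum>x\<in>#N. poly p x)"
proof -
  have swap: "(\<Sum>x\<in>#L. poly p x) = (\<Sum>k\<le>degree p. coeff p k * (\<Sum>x\<in>#L. x ^ k))"
    for L :: "'a multiset"
    by (induction L) (simp_all add: poly_altdef algebra_simps sum.distrib)
  show ?thesis by (simp add: swap assms)
qed

lemma mset_eq_if_power_sums_eq:
  fixes M N :: "'a :: {idom, ring_char_0} multiset"
  assumes "\<And>k. (\<Sum>x\<in>#M. x ^ k) = (\<Sum>x\<in>#N. x ^ k)"
  shows "M = N"
proof (rule multiset_eqI)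
  fix a
  \<comment> \<open>A polynomial vanishing on all elements other than \<open>a\<close> isolates the multiplicity of \<open>a\<close>.\<close>
  define S where "S = (set_mset M \<union> set_mset N) - {a}"
  define p where "p = (\<Prod>b\<in>S. [:- b, 1:])"
  have fin: "finite S" by (simp add: S_def)
  have zero: "poly p x = 0" if "x \<in> S" for x
    using that fin by (auto simp: p_def poly_prod)
  have nonzero: "poly p a \<noteq> 0"
    using fin by (auto simp: p_def poly_prod S_def)
  have isolate: "(\<Sum>x\<in>#L. poly p x) = of_nat (count L a) * poly p a"
    if "set_mset L \<subseteq> insert a S" for L
    using that by (induction L) (auto simp: zero algebra_simps)
  have "(\<Sum>x\<in>#M. poly p x) = (\<Sum>x\<in>#N. poly p x)"
    using assms by (rule sum_mset_poly_eq_if_power_sums_eq)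
  then have "of_nat (count M a) * poly p a = of_nat (count N a) * poly p a"
    by (subst (asm) (1 2) isolate) (auto simp: S_def)
  \<comment> \<open>Characteristic 0 makes \<open>of_nat\<close> injective, so cancelling
    \<open>poly p a\<close> leaves the multiplicities themselves.\<close>
  then show "count M a = count N a"
    using nonzero by simp
qed

section \<open>Traces of powers\<close>

lemma sum_diag_mult_commute:
  fixes A B :: "'a :: comm_semiring_0 mat"
  assumes "A \<in> carrier_mat n n" "B \<in> carrier_mat n n"
  shows "(\<Sum>i<n. (A * B) $$ (i, i)) = (\<Sum>i<n. (B * A) $$ (i, i))"
proof -
  have "(\<Sum>i<n. (A * B) $$ (i, i)) = (\<Sum>i<n. \<Sum>j<n. A $$ (i, j) * B $$ (j, i))"
    using assms by (simp add: scalar_prod_def atLeast0LessThan)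
  also have "\<dots> = (\<Sum>j<n. \<Sum>i<n. B $$ (j, i) * A $$ (i, j))"
    by (subst sum.swap) (simp add: mult.commute)
  also have "\<dots> = (\<Sum>i<n. (B * A) $$ (i, i))"
    using assms by (simp add: scalar_prod_def atLeast0LessThan)
  finally show ?thesis .
qed

text \<open>A term of the product sum survives only for \<open>i \<le> l \<le> j\<close>: never if
  \<open>j < i\<close>, and only for \<open>l = i\<close> on the diagonal. Both claims share one
  induction because the diagonal one needs the zeros below the diagonal of the previous
  power.\<close>

lemma upper_triangular_pow:
  fixes B :: "'a :: comm_semiring_1 mat"
  assumes B: "B \<in> carrier_mat n n" and ut: "upper_triangular B"
  shows "j < i \<Longrightarrow> i < n \<Longrightarrow> (B ^\<^sub>m k) $$ (i, j) = 0"
    and "i < n \<Longrightarrow> (B ^\<^sub>m k) $$ (i, i) = B $$ (i, i) ^ k"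
proof (induction k arbitrary: i j)
  case 0
  { case 1 then show ?case using B by simp }
  { case 2 then show ?case using B by simp }
next
  case (Suc k)
  have C: "B ^\<^sub>m k \<in> carrier_mat n n" using B by simp
  have entry: "(B ^\<^sub>m Suc k) $$ (i, j) = (\<Sum>l<n. (B ^\<^sub>m k) $$ (i, l) * B $$ (l, j))"
    if "i < n" "j < n" for i j
    using that B C by (simp add: scalar_prod_def atLeast0LessThan)
  have vanish: "(B ^\<^sub>m k) $$ (i, l) * B $$ (l, j) = 0"
    if "i < n" "l < n" "l < i \<or> j < l" for i j l
    using that Suc.IH(1)[of l i] upper_triangularD[OF ut, of j l] B by auto
  {
    case 1
    then have "(B ^\<^sub>m Suc k) $$ (i, j) = (\<Sum>l<n. (B ^\<^sub>m k) $$ (i, l) * B $$ (l, j))"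
      by (intro entry) auto
    also have "\<dots> = 0"
      using 1 by (intro sum.neutral ballI vanish) auto
    finally show ?case .
  next
    case 2
    then have "(B ^\<^sub>m Suc k) $$ (i, i) = (\<Sum>l<n. (B ^\<^sub>m k) $$ (i, l) * B $$ (l, i))"
      by (intro entry)
    also have "\<dots> = (\<Sum>l\<in>{i}. (B ^\<^sub>m k) $$ (i, l) * B $$ (l, i))"
      using 2 by (intro sum.mono_neutral_right ballI vanish) auto
    finally show ?case using Suc.IH(2)[OF 2] by (simp add: mult.commute)
  }
qed

lemma eigenvalue_mset_eqI:
  assumes "char_poly A = (\<Prod>a\<leftarrow>es. [:- a, 1:])"
  shows "eigenvalue_mset A = mset es"
proof -
  have "proots (\<Prod>a\<leftarrow>es. [:- a, 1:]) = mset es" for es :: "complex list"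
  proof (induction es)
    case (Cons a es)
    have "(\<Prod>a\<leftarrow>es. [:- a, 1:]) \<noteq> 0"
      by (auto simp: prod_list_zero_iff)
    then have "proots ([:- a, 1:] * (\<Prod>a\<leftarrow>es. [:- a, 1:])) =
        proots [:- a, 1:] + proots (\<Prod>a\<leftarrow>es. [:- a, 1:])"
      by (intro proots_mult) auto
    then show ?case by (simp add: Cons.IH del: mult_pCons_left)
  qed simp
  then show ?thesis by (simp add: eigenvalue_mset_def assms)
qed

text \<open>Schur decomposition makes \<open>A\<close> similar to a triangular \<open>B\<close> with
  the eigenvalues on its diagonal. The trace is invariant under similarity, and the diagonal of
  \<open>B ^\<^sub>m k\<close> consists of the powers of these eigenvalues.\<close>

lemma sum_diag_pow_eq_power_sum:
  assumes A: "A \<in> carrier_mat n n"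
  shows "(\<Sum>i<n. (A ^\<^sub>m k) $$ (i, i)) = (\<Sum>x\<in>#eigenvalue_mset A. x ^ k)"
proof -
  obtain es where es: "char_poly A = (\<Prod>a\<leftarrow>es. [:- a, 1:])"
    using char_poly_factorized[OF A] by blast
  obtain B P Q where schur: "schur_decomposition A es = (B, P, Q)"
    by (cases "schur_decomposition A es")
  from schur_decomposition[OF A es schur] have wit: "similar_mat_wit A B P Q"
    and ut: "upper_triangular B" and diag: "diag_mat B = es" by auto
  from similar_mat_witD2[OF A wit] have B: "B \<in> carrier_mat n n"
    and P: "P \<in> carrier_mat n n" and Q: "Q \<in> carrier_mat n n" and QP: "Q * P = 1\<^sub>m n"
    by auto
  have Bk: "B ^\<^sub>m k \<in> carrier_mat n n" using B by simp
  have "(\<Sum>i<n. (A ^\<^sub>m k) $$ (i, i)) = (\<Sum>i<n. (P * B ^\<^sub>m k * Q) $$ (i, i))"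
    by (simp only: similar_mat_wit_pow_id[OF wit])
  also have "\<dots> = (\<Sum>i<n. (Q * (P * B ^\<^sub>m k)) $$ (i, i))"
    using P Q Bk by (intro sum_diag_mult_commute) auto
  also have "Q * (P * B ^\<^sub>m k) = B ^\<^sub>m k"
    using P Q Bk by (simp flip: assoc_mult_mat[OF Q P Bk] add: QP left_mult_one_mat[OF Bk])
  also have "(\<Sum>i<n. (B ^\<^sub>m k) $$ (i, i)) = (\<Sum>i<n. B $$ (i, i) ^ k)"
    using upper_triangular_pow(2)[OF B ut] by simp
  also have "\<dots> = (\<Sum>x\<leftarrow>diag_mat B. x ^ k)"
    using B by (simp add: diag_mat_def o_def interv_sum_list_conv_sum_set_nat atLeast0LessThan)
  also have "\<dots> = (\<Sum>x\<in>#eigenvalue_mset A. x ^ k)"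
    unfolding eigenvalue_mset_eqI[OF es] diag
    by (metis mset_map sum_mset_sum_list)
  finally show ?thesis .
qed

section \<open>Weighted walks\<close>

text \<open>This is the entry \<open>(x, y)\<close> of the \<open>k\<close>-th power of the matrix
  \<open>f\<close>, but with an arbitrary index set \<open>V\<close>. List positions, vertices and
  pairs (block, position) can then all serve as indices, without arithmetic to flatten pairs into
  numbers.\<close>

fun walk_weight :: "'v set \<Rightarrow> ('v \<Rightarrow> 'v \<Rightarrow> 'c :: comm_semiring_1) \<Rightarrow> nat \<Rightarrow> 'v \<Rightarrow> 'v \<Rightarrow> 'c" where
  "walk_weight V f 0 x y = of_bool (x = y)"
| "walk_weight V f (Suc k) x y = (\<Sum>z\<in>V. walk_weight V f k x z * f z y)"

lemma walk_weight_cong: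
  assumes "\<And>x y. x \<in> V \<Longrightarrow> y \<in> V \<Longrightarrow> f x y = g x y" "y \<in> V"
  shows "walk_weight V f k x y = walk_weight V g k x y"
  using assms(2) by (induction k arbitrary: y) (simp_all add: assms(1))

lemma walk_weight_reindex:
  assumes "bij_betw h U V" "x \<in> U" "y \<in> U"
  shows "walk_weight V f k (h x) (h y) = walk_weight U (\<lambda>x y. f (h x) (h y)) k x y"
  using assms(3)
proof (induction k arbitrary: y)
  case 0
  then show ?case
    using assms(2) inj_on_eq_iff[OF bij_betw_imp_inj_on[OF assms(1)]] by simp
next
  case (Suc k)
  have "walk_weight V f (Suc k) (h x) (h y) =
      (\<Sum>z\<in>U. walk_weight V f k (h x) (h z) * f (h z) (h y))"
    unfolding walk_weight.simps by (rule sum.reindex_bij_betw[OF assms(1), symmetric])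
  then show ?case by (simp add: Suc.IH)
qed

lemma pow_mat_eq_walk_weight:
  assumes "p < n" "q < n"
  shows "(mat n n (\<lambda>(p, q). f p q) ^\<^sub>m k) $$ (p, q) = walk_weight {..<n} f k p q"
  using assms(2)
proof (induction k arbitrary: q)
  case 0
  then show ?case using assms by simp
next
  case (Suc k)
  then show ?case
    using assms by (simp add: scalar_prod_def atLeast0LessThan)
qed

text \<open>The right-hand side no longer mentions \<open>xs\<close>, which settles independence of
  the enumeration.\<close>

lemma power_sum_adjacency_matrix:
  assumes "distinct xs" "set xs = V"
  shows "(\<Sum>x\<in>#eigenvalue_mset (adjacency_matrix xs G). x ^ k) =
    (\<Sum>u\<in>V. walk_weight V (\<lambda>u w. of_bool ((u, w) \<in> parcs G)) k u u)"
proof -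
  let ?n = "length xs" and ?f = "\<lambda>u w. of_bool ((u, w) \<in> parcs G) :: complex"
  have bij: "bij_betw ((!) xs) {..<?n} V"
    using assms by (intro bij_betw_nth) auto
  have adj: "adjacency_matrix xs G = mat ?n ?n (\<lambda>(p, q). ?f (xs ! p) (xs ! q))"
    by (rule eq_matI) (simp_all add: adjacency_matrix_def)
  have "(\<Sum>x\<in>#eigenvalue_mset (adjacency_matrix xs G). x ^ k) =
      (\<Sum>p<?n. (adjacency_matrix xs G ^\<^sub>m k) $$ (p, p))"
    by (rule sum_diag_pow_eq_power_sum[symmetric]) (simp add: adj)
  also have "\<dots> = (\<Sum>p<?n. walk_weight V ?f k (xs ! p) (xs ! p))"
  proof (intro sum.cong refl)
    fix p assume "p \<in> {..<?n}"
    then show "(adjacency_matrix xs G ^\<^sub>m k) $$ (p, p) = walk_weight V ?f k (xs ! p) (xs ! p)"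
      unfolding adj walk_weight_reindex[OF bij \<open>p \<in> {..<?n}\<close> \<open>p \<in> {..<?n}\<close>]
      by (intro pow_mat_eq_walk_weight) auto
  qed
  also have "\<dots> = (\<Sum>u\<in>V. walk_weight V ?f k u u)"
    using sum.reindex_bij_betw[OF bij, of "\<lambda>u. walk_weight V ?f k u u"] .
  finally show ?thesis .
qed

section \<open>Block matrices with commuting blocks\<close>

text \<open>An index \<open>(i, \<alpha>)\<close> is position \<open>\<alpha>\<close> of block \<open>i\<close>.\<close>

locale commuting_blocks =
  fixes J I :: "nat set" and f :: "nat \<times> nat \<Rightarrow> nat \<times> nat \<Rightarrow> 'c :: comm_semiring_1"
  assumes blocks_commute:
    "\<lbrakk>i \<in> J; j \<in> J; i' \<in> J; j' \<in> J; \<alpha> \<in> I; \<beta> \<in> I\<rbrakk> \<Longrightarrow>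
      (\<Sum>\<gamma>\<in>I. f (i, \<alpha>) (j, \<gamma>) * f (i', \<gamma>) (j', \<beta>)) =
      (\<Sum>\<gamma>\<in>I. f (i', \<alpha>) (j', \<gamma>) * f (i, \<gamma>) (j, \<beta>))"
begin

abbreviation W :: "nat \<Rightarrow> nat \<times> nat \<Rightarrow> nat \<times> nat \<Rightarrow> 'c" where
  "W \<equiv> walk_weight (J \<times> I) f"

text \<open>The block \<open>(i, j)\<close> of the power \<open>k + 1\<close> is the sum over
  \<open>l\<close> of the block \<open>(i, l)\<close> of the power \<open>k\<close> times the block
  \<open>(l, j)\<close> of \<open>f\<close>. A further block of \<open>f\<close> is moved past these
  two factors in turn. As \<open>l\<close> varies, the induction has to generalise
  \<open>j\<close>.\<close>

lemma walk_weight_blocks_commute: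
  assumes "i \<in> J" "j \<in> J" "i' \<in> J" "j' \<in> J" "\<alpha> \<in> I" "\<beta> \<in> I" "finite I"
  shows "(\<Sum>\<gamma>\<in>I. W k (i, \<alpha>) (j, \<gamma>) * f (i', \<gamma>) (j', \<beta>)) =
    (\<Sum>\<gamma>\<in>I. f (i', \<alpha>) (j', \<gamma>) * W k (i, \<gamma>) (j, \<beta>))"
  using assms(2,5,6)
proof (induction k arbitrary: j \<alpha> \<beta>)
  case 0
  show ?case
    using 0 assms(7)
    by (cases "i = j")
      (simp_all add: of_bool_def if_distrib[of "\<lambda>x. x * _"]
        if_distrib[of "\<lambda>x. _ * x"] cong: if_cong)
next
  case (Suc k)
  have "(\<Sum>\<gamma>\<in>I. W (Suc k) (i, \<alpha>) (j, \<gamma>) * f (i', \<gamma>) (j', \<beta>)) =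
      (\<Sum>\<gamma>\<in>I. \<Sum>l\<in>J. \<Sum>\<delta>\<in>I. W k (i, \<alpha>) (l, \<delta>) * (f (l, \<delta>) (j, \<gamma>) * f (i', \<gamma>) (j', \<beta>)))"
    by (simp add: sum.cartesian_product' sum_distrib_right mult.assoc)
  also have "\<dots> = (\<Sum>l\<in>J. \<Sum>\<delta>\<in>I. W k (i, \<alpha>) (l, \<delta>) *
      (\<Sum>\<gamma>\<in>I. f (l, \<delta>) (j, \<gamma>) * f (i', \<gamma>) (j', \<beta>)))"
    by (subst sum.swap, rule sum.cong[OF refl], subst sum.swap) (simp add: sum_distrib_left)
  \<comment> \<open>Past the single block \<open>(l, j)\<close>, by the locale assumption.\<close>
  also have "\<dots> = (\<Sum>l\<in>J. \<Sum>\<delta>\<in>I. W k (i, \<alpha>) (l, \<delta>) *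
      (\<Sum>\<gamma>\<in>I. f (i', \<delta>) (j', \<gamma>) * f (l, \<gamma>) (j, \<beta>)))"
    using assms Suc.prems by (intro sum.cong refl arg_cong2[where f = "(*)"] blocks_commute)
  also have "\<dots> = (\<Sum>l\<in>J. \<Sum>\<gamma>\<in>I. (\<Sum>\<delta>\<in>I. W k (i, \<alpha>) (l, \<delta>) * f (i', \<delta>) (j', \<gamma>)) *
      f (l, \<gamma>) (j, \<beta>))"
    by (rule sum.cong[OF refl], unfold sum_distrib_left sum_distrib_right, subst sum.swap)
      (simp add: mult.assoc)
  \<comment> \<open>Past the block of the power, by the induction hypothesis at
    \<open>l\<close>.\<close>
  also have "\<dots> = (\<Sum>l\<in>J. \<Sum>\<gamma>\<in>I. (\<Sum>\<delta>\<in>I. f (i', \<alpha>) (j', \<delta>) * W k (i, \<delta>) (l, \<gamma>)) *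
      f (l, \<gamma>) (j, \<beta>))"
    using Suc.prems by (intro sum.cong refl arg_cong2[where f = "(*)"] Suc.IH)
  also have "\<dots> = (\<Sum>l\<in>J. \<Sum>\<delta>\<in>I. \<Sum>\<gamma>\<in>I. f (i', \<alpha>) (j', \<delta>) * (W k (i, \<delta>) (l, \<gamma>) *
      f (l, \<gamma>) (j, \<beta>)))"
    by (rule sum.cong[OF refl], unfold sum_distrib_right, subst sum.swap)
      (simp add: mult.assoc)
  also have "\<dots> = (\<Sum>\<delta>\<in>I. f (i', \<alpha>) (j', \<delta>) * W (Suc k) (i, \<delta>) (j, \<beta>))"
    by (subst sum.swap) (simp add: sum.cartesian_product' sum_distrib_left)
  finally show ?case .
qed

lemma walk_weight_partial_transpose:
  assumes "finite I" "i \<in> J" "j \<in> J" "\<alpha> \<in> I" "\<beta> \<in> I"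
  shows "walk_weight (J \<times> I) (\<lambda>(i, \<alpha>) (j, \<beta>). f (i, \<beta>) (j, \<alpha>)) k (i, \<alpha>) (j, \<beta>) =
    W k (i, \<beta>) (j, \<alpha>)"
  using assms(3,5)
proof (induction k arbitrary: j \<beta>)
  case 0
  then show ?case by auto
next
  case (Suc k)
  let ?f = "\<lambda>(i, \<alpha>) (j, \<beta>). f (i, \<beta>) (j, \<alpha>)"
  have "walk_weight (J \<times> I) ?f (Suc k) (i, \<alpha>) (j, \<beta>) =
      (\<Sum>l\<in>J. \<Sum>\<gamma>\<in>I. walk_weight (J \<times> I) ?f k (i, \<alpha>) (l, \<gamma>) * f (l, \<beta>) (j, \<gamma>))"
    by (simp add: sum.cartesian_product')
  also have "\<dots> = (\<Sum>l\<in>J. \<Sum>\<gamma>\<in>I. f (l, \<beta>) (j, \<gamma>) * W k (i, \<gamma>) (l, \<alpha>))"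
    by (intro sum.cong refl) (simp add: Suc.IH mult.commute)
  \<comment> \<open>Transposing a product of blocks has reversed its factors; commutation restores
    their order.\<close>
  also have "\<dots> = (\<Sum>l\<in>J. \<Sum>\<gamma>\<in>I. W k (i, \<beta>) (l, \<gamma>) * f (l, \<gamma>) (j, \<alpha>))"
    using assms Suc.prems
    by (intro sum.cong[OF refl] walk_weight_blocks_commute[symmetric])
  also have "\<dots> = W (Suc k) (i, \<beta>) (j, \<alpha>)"
    by (simp add: sum.cartesian_product')
  finally show ?case .
qed

end

section \<open>Cospectrality\<close>

lemma cospectral_if_closed_walks_eq:
  assumes "finite V" "pverts G = V" "pverts H = V"
    and "\<And>k. (\<Sum>u\<in>V. walk_weight V (\<lambda>u w. of_bool ((u, w) \<in> parcs G)) k u u :: complex) =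
      (\<Sum>u\<in>V. walk_weight V (\<lambda>u w. of_bool ((u, w) \<in> parcs H)) k u u)"
  shows "cospectral G H"
  unfolding cospectral_def
proof (intro conjI allI impI)
  fix xs ys
  assume *: "distinct xs \<and> set xs = pverts G \<and> distinct ys \<and> set ys = pverts H"
  show "eigenvalue_mset (adjacency_matrix xs G) = eigenvalue_mset (adjacency_matrix ys H)"
  proof (rule mset_eq_if_power_sums_eq)
    show "(\<Sum>x\<in>#eigenvalue_mset (adjacency_matrix xs G). x ^ k) =
        (\<Sum>x\<in>#eigenvalue_mset (adjacency_matrix ys H). x ^ k)" for k
      using * assms by (simp add: power_sum_adjacency_matrix[where V = V])
  qed
qed (simp_all add: assms)

text \<open>Once the arcs at \<open>w\<close> are reversed by symmetry, the sum is an entry of a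
  product of two blocks of the adjacency matrix.\<close>

lemma card_nbd_Int:
  "of_nat (card (nbd m v G j u \<inter> nbd m v G j' w)) =
    (\<Sum>\<gamma>\<in>{1..m}. of_bool ((u, v j \<gamma>) \<in> parcs G) * of_bool ((w, v j' \<gamma>) \<in> parcs G) ::
      'c :: comm_semiring_1)"
proof -
  have "nbd m v G j u \<inter> nbd m v G j' w =
      {\<gamma> \<in> {1..m}. (u, v j \<gamma>) \<in> parcs G \<and> (w, v j' \<gamma>) \<in> parcs G}"
    by (auto simp: nbd_def)
  then show ?thesis by (simp flip: of_bool_conj add: Int_def)
qed

lemma clustered_graph_sym:
  assumes "clustered_graph m n v G"
  shows "(u, w) \<in> parcs G \<longleftrightarrow> (w, u) \<in> parcs G"
proof -
  interpret pair_graph G using assms by (simp add: clustered_graph_def)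
  show ?thesis using pair_sym_arcs by (auto simp: symmetric_def sym_def)
qed

theorem theorem6:
  fixes m n :: nat and v :: "nat \<Rightarrow> nat \<Rightarrow> 'a" and G :: "'a pair_pre_digraph"
  assumes "clustered_graph m n v G"
    and commuting: "\<forall>i1\<in>{1..n}. \<forall>j1\<in>{1..n}. \<forall>i2\<in>{1..n}. \<forall>j2\<in>{1..n}.
      \<forall>\<alpha>\<in>{1..m}. \<forall>\<beta>\<in>{1..m}.
        card (nbd m v G j1 (v i1 \<alpha>) \<inter> nbd m v G i2 (v j2 \<beta>)) =
        card (nbd m v G i1 (v j1 \<beta>) \<inter> nbd m v G j2 (v i2 \<alpha>))"
    and normality: "\<forall>i\<in>{1..n}. \<forall>j\<in>{1..n}. i \<noteq> j \<longrightarrow>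
      (\<forall>\<alpha>\<in>{1..m}. \<forall>\<beta>\<in>{1..m}.
        card (common_neighbours G (cluster m v j) (v i \<alpha>) (v i \<beta>)) =
        card (common_neighbours G (cluster m v i) (v j \<alpha>) (v j \<beta>)))"
  shows "cospectral G (partial_transpose m n v G)"
proof -
  let ?V = "pverts G" and ?P = "partial_transpose m n v G"
  let ?U = "{1..n} \<times> {1..m}" and ?h = "\<lambda>(i, \<alpha>). v i \<alpha>"
  let ?a = "\<lambda>H u w. of_bool ((u, w) \<in> parcs H) :: complex"
  \<comment> \<open>The adjacency matrix of \<open>G\<close> is pulled back to label pairs, where
    the block structure is visible.\<close>
  define f where "f = (\<lambda>x y. ?a G (?h x) (?h y))"
  have bij: "bij_betw ?h ?U ?V"
    using assms(1) by (simp add: clustered_graph_def)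
  interpret commuting_blocks "{1..n}" "{1..m}" f
  proof
    fix i j i' j' \<alpha> \<beta>
    assume mem: "i \<in> {1..n}" "j \<in> {1..n}" "i' \<in> {1..n}" "j' \<in> {1..n}"
      "\<alpha> \<in> {1..m}" "\<beta> \<in> {1..m}"
    \<comment> \<open>The two cardinalities in the commuting condition are the \<alpha>, \<beta>
      entries of the products, in either order, of the blocks \<open>(i, j)\<close> and
      \<open>(i', j')\<close>.\<close>
    have "(\<Sum>\<gamma>\<in>{1..m}. f (i, \<alpha>) (j, \<gamma>) * f (i', \<gamma>) (j', \<beta>)) =
        of_nat (card (nbd m v G j (v i \<alpha>) \<inter> nbd m v G i' (v j' \<beta>)))"
      unfolding card_nbd_Int f_def
      by (simp add: clustered_graph_sym[OF assms(1), of _ "v j' \<beta>"])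
    also have "\<dots> = of_nat (card (nbd m v G j' (v i' \<alpha>) \<inter> nbd m v G i (v j \<beta>)))"
      using commuting[rule_format, OF mem] by (simp only: Int_commute)
    also have "\<dots> = (\<Sum>\<gamma>\<in>{1..m}. f (i', \<alpha>) (j', \<gamma>) * f (i, \<gamma>) (j, \<beta>))"
      unfolding card_nbd_Int f_def
      by (simp add: clustered_graph_sym[OF assms(1), of _ "v j \<beta>"])
    finally show "(\<Sum>\<gamma>\<in>{1..m}. f (i, \<alpha>) (j, \<gamma>) * f (i', \<gamma>) (j', \<beta>)) =
        (\<Sum>\<gamma>\<in>{1..m}. f (i', \<alpha>) (j', \<gamma>) * f (i, \<gamma>) (j, \<beta>))" .
  qed
  have closed: "(\<Sum>u\<in>?V. walk_weight ?V (?a H) k u u) =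
      (\<Sum>x\<in>?U. walk_weight ?U (\<lambda>x y. ?a H (?h x) (?h y)) k x x)" for H k
    unfolding sum.reindex_bij_betw[OF bij, symmetric]
    by (intro sum.cong refl walk_weight_reindex[OF bij])
  show ?thesis
  proof (rule cospectral_if_closed_walks_eq)
    show "finite ?V" using bij bij_betw_finite by blast
    show "pverts ?P = ?V" by (simp add: partial_transpose_def)
    fix k
    have "walk_weight ?U (\<lambda>x y. ?a ?P (?h x) (?h y)) k x x = walk_weight ?U f k x x"
      if "x \<in> ?U" for x
    proof -
      obtain i \<alpha> where x: "x = (i, \<alpha>)" "i \<in> {1..n}" "\<alpha> \<in> {1..m}"
        using \<open>x \<in> ?U\<close> by blast
      have "walk_weight ?U (\<lambda>x y. ?a ?P (?h x) (?h y)) k x x =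
          walk_weight ?U (\<lambda>(i, \<alpha>) (j, \<beta>). f (i, \<beta>) (j, \<alpha>)) k x x"
        using \<open>x \<in> ?U\<close>
        by (intro walk_weight_cong)
          (auto simp: f_def partial_transpose_adjacent_iff[OF assms(1)])
      \<comment> \<open>For a closed walk both endpoints have the same position \<alpha>, so
        swapping the positions changes nothing.\<close>
      also have "\<dots> = walk_weight ?U f k x x"
        unfolding x(1) using x by (intro walk_weight_partial_transpose) auto
      finally show ?thesis .
    qed
    then show "(\<Sum>u\<in>?V. walk_weight ?V (?a G) k u u) = (\<Sum>u\<in>?V. walk_weight ?V (?a ?P) k u u)"
      unfolding closed f_def[symmetric] by simp
  qed simp
qed

end
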